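(* Let $\Bbbk$ be a field of characteristic $0$ and let $f, g \in \Bbbk[t]\setminus\{0\}$ be such that $f'g \in \Bbbk[f]$ and $\deg(f) \geq 1$. Then the universal enveloping algebra $U(L(f,g))$ of the Lie algebra $L(f,g)$ is not noetherian.
   Context: $W_{\geq -1} = \operatorname{Der}(\Bbbk[t]) = \Bbbk[t]\partial$, where $\partial$ is differentiation with respect to $t$, with Lie bracket $[p\partial, q\partial] = (pq' - p'q)\partial$. For $f,g \in \Bbbk[t]\setminus\{0\}$, $L(f,g) = \Bbbk[f]\,g\,\partial$ is the subspace of $W_{\geq -1}$ spanned by $\{f^n g \partial \mid n \in \mathbb{N}\}$ with $\mathbb{N} \ni 0$; it is a Lie subalgebra of $W_{\geq -1}$ when $f'g \in \Bbbk[f]$. Noetherian means left and right noetherian (equivalent to each other for universal enveloping algebras). *)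

theory Defs
  imports
    "HOL-Library.Poly_Mapping"
    "HOL-Computational_Algebra.Polynomial"
    "HOL-Algebra.QuotRing"
begin

section \<open>Left and right noetherian rings\<close>

text \<open>The ideals of \<open>HOL-Algebra.Ideal\<close>, and hence its \<open>noetherian_ring\<close>, are two-sided.\<close>

definition left_ideal :: "'a set \<Rightarrow> ('a, 'm) ring_scheme \<Rightarrow> bool" where
  "left_ideal I R \<longleftrightarrow> additive_subgroup I R \<and> (\<forall>r \<in> carrier R. \<forall>a \<in> I. r \<otimes>\<^bsub>R\<^esub> a \<in> I)"

definition right_ideal :: "'a set \<Rightarrow> ('a, 'm) ring_scheme \<Rightarrow> bool" where
  "right_ideal I R \<longleftrightarrow> additive_subgroup I R \<and> (\<forall>r \<in> carrier R. \<forall>a \<in> I. a \<otimes>\<^bsub>R\<^esub> r \<in> I)"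

definition left_noetherian :: "('a, 'm) ring_scheme \<Rightarrow> bool" where
  "left_noetherian R \<longleftrightarrow> (\<forall>I. left_ideal I R \<longrightarrow>
     (\<exists>A \<subseteq> carrier R. finite A \<and> I = \<Inter> {J. left_ideal J R \<and> A \<subseteq> J}))"

definition right_noetherian :: "('a, 'm) ring_scheme \<Rightarrow> bool" where
  "right_noetherian R \<longleftrightarrow> (\<forall>I. right_ideal I R \<longrightarrow>
     (\<exists>A \<subseteq> carrier R. finite A \<and> I = \<Inter> {J. right_ideal J R \<and> A \<subseteq> J}))"

definition noetherian :: "('a, 'm) ring_scheme \<Rightarrow> bool" where
  "noetherian R \<longleftrightarrow> left_noetherian R \<and> right_noetherian R"


section \<open>Lie algebras\<close>

text \<open>A Lie algebra is carried by a subspace \<open>L\<close> of an ambient vector space; the bracket only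
  matters on \<open>L\<close>.\<close>

locale lie_algebra = vector_space scale
  for scale :: "'k::field \<Rightarrow> 'v::ab_group_add \<Rightarrow> 'v" +
  fixes bracket :: "'v \<Rightarrow> 'v \<Rightarrow> 'v" and L :: "'v set"
  assumes subspace_L: "subspace L"
    and bracket_closed: "x \<in> L \<Longrightarrow> y \<in> L \<Longrightarrow> bracket x y \<in> L"
    and bracket_add_left: "x \<in> L \<Longrightarrow> y \<in> L \<Longrightarrow> z \<in> L \<Longrightarrow> bracket (x + y) z = bracket x z + bracket y z"
    and bracket_add_right: "x \<in> L \<Longrightarrow> y \<in> L \<Longrightarrow> z \<in> L \<Longrightarrow> bracket x (y + z) = bracket x y + bracket x z"
    and bracket_scale_left: "x \<in> L \<Longrightarrow> y \<in> L \<Longrightarrow> bracket (scale c x) y = scale c (bracket x y)"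
    and bracket_scale_right: "x \<in> L \<Longrightarrow> y \<in> L \<Longrightarrow> bracket x (scale c y) = scale c (bracket x y)"
    and bracket_alternating: "x \<in> L \<Longrightarrow> bracket x x = 0"
    and jacobi: "x \<in> L \<Longrightarrow> y \<in> L \<Longrightarrow> z \<in> L \<Longrightarrow>
      bracket x (bracket y z) + bracket y (bracket z x) + bracket z (bracket x y) = 0"


section \<open>The universal enveloping algebra\<close>

text \<open>Words are a copy of lists, made an additive monoid under concatenation so that the
  convolution product of \<open>Poly_Mapping\<close> is the multiplication of the free algebra.\<close>

datatype 'a fword = FWord (letters: "'a list")

instantiation fword :: (type) monoid_add
begin

definition zero_fword :: "'a fword" where "0 = FWord []"

definition plus_fword :: "'a fword \<Rightarrow> 'a fword \<Rightarrow> 'a fword" where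
  "u + v = FWord (letters u @ letters v)"

instance
  by standard (simp_all add: zero_fword_def plus_fword_def)

end

definition free_algebra :: "'v set \<Rightarrow> ('v fword \<Rightarrow>\<^sub>0 'k::field) ring" where
  "free_algebra X =
     \<lparr>carrier = {p. \<forall>w \<in> Poly_Mapping.keys p. set (letters w) \<subseteq> X}, mult = (*), one = 1, zero = 0, add = (+)\<rparr>"

definition free_gen :: "'v \<Rightarrow> ('v fword \<Rightarrow>\<^sub>0 'k::field)" where
  "free_gen x = Poly_Mapping.single (FWord [x]) 1"

text \<open>The free algebra on the underlying set of \<open>L\<close>, modulo the first two families of relations, is
  the tensor algebra \<open>T(L)\<close>; the third family gives \<open>xy - yx = [x,y]\<close>. A one-letter word with
  coefficient \<open>c\<close> is \<open>c\<close> times the generator.\<close>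

definition enveloping_relations ::
  "('k::field \<Rightarrow> 'v::ab_group_add \<Rightarrow> 'v) \<Rightarrow> ('v \<Rightarrow> 'v \<Rightarrow> 'v) \<Rightarrow> 'v set \<Rightarrow> ('v fword \<Rightarrow>\<^sub>0 'k) set"
where
  "enveloping_relations scale bracket L =
     {free_gen (x + y) - free_gen x - free_gen y | x y. x \<in> L \<and> y \<in> L} \<union>
     {free_gen (scale c x) - Poly_Mapping.single (FWord [x]) c | c x. x \<in> L} \<union>
     {free_gen x * free_gen y - free_gen y * free_gen x - free_gen (bracket x y) | x y. x \<in> L \<and> y \<in> L}"

definition enveloping_algebra ::
  "('k::field \<Rightarrow> 'v::ab_group_add \<Rightarrow> 'v) \<Rightarrow> ('v \<Rightarrow> 'v \<Rightarrow> 'v) \<Rightarrow> 'v set \<Rightarrow> ('v fword \<Rightarrow>\<^sub>0 'k) set ring"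
where
  "enveloping_algebra scale bracket L =
     free_algebra L Quot (genideal (free_algebra L) (enveloping_relations scale bracket L))"

lemma ring_free_algebra: "ring (free_algebra X :: ('v fword \<Rightarrow>\<^sub>0 'k::field) ring)"
proof -
  let ?F = "free_algebra X :: ('v fword \<Rightarrow>\<^sub>0 'k) ring"
  have ops: "x \<oplus>\<^bsub>?F\<^esub> y = x + y" "x \<otimes>\<^bsub>?F\<^esub> y = x * y" "\<zero>\<^bsub>?F\<^esub> = 0" "\<one>\<^bsub>?F\<^esub> = 1" for x y
    by (simp_all add: free_algebra_def)
  have add: "p + q \<in> carrier ?F" if "p \<in> carrier ?F" "q \<in> carrier ?F" for p q
    using that Poly_Mapping.keys_add[of p q] unfolding free_algebra_def by auto
  have neg: "- p \<in> carrier ?F" if "p \<in> carrier ?F" for p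
    using that by (simp add: free_algebra_def)
  have mult: "p * q \<in> carrier ?F" if "p \<in> carrier ?F" "q \<in> carrier ?F" for p q
    using that Poly_Mapping.keys_mult[of p q]
    by (fastforce simp: free_algebra_def plus_fword_def)
  have zero: "0 \<in> carrier ?F" and one: "1 \<in> carrier ?F"
    by (simp_all add: free_algebra_def zero_fword_def)
  show ?thesis
  proof (rule ringI)
    show "abelian_group ?F"
    proof (rule abelian_groupI)
      fix x assume "x \<in> carrier ?F"
      then show "\<exists>y \<in> carrier ?F. y \<oplus>\<^bsub>?F\<^esub> x = \<zero>\<^bsub>?F\<^esub>"
        by (intro bexI[of _ "- x"]) (simp_all add: ops neg)
    qed (simp_all add: ops add zero add.assoc add.commute)
    show "Group.monoid ?F"
      by (rule monoidI) (simp_all add: ops mult one mult.assoc)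
  qed (simp_all add: ops distrib_left distrib_right)
qed

lemma (in lie_algebra) enveloping_relations_carrier:
  "enveloping_relations scale bracket L \<subseteq> carrier (free_algebra L)"
proof -
  let ?F = "free_algebra L :: ('v fword \<Rightarrow>\<^sub>0 'k) ring"
  have single: "Poly_Mapping.single (FWord [x]) c \<in> carrier ?F" if "x \<in> L" for x and c :: 'k
    using that by (simp add: free_algebra_def)
  have diff: "p - q \<in> carrier ?F" if "p \<in> carrier ?F" "q \<in> carrier ?F" for p q
    using that Poly_Mapping.keys_diff[of p q] unfolding free_algebra_def by auto
  have mult: "p * q \<in> carrier ?F" if "p \<in> carrier ?F" "q \<in> carrier ?F" for p q
    using that Poly_Mapping.keys_mult[of p q]
    by (fastforce simp: free_algebra_def plus_fword_def)
  show ?thesis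
    unfolding enveloping_relations_def free_gen_def
    by (auto intro!: diff mult single bracket_closed
          subspace_add[OF subspace_L] subspace_scale[OF subspace_L])
qed

lemma (in lie_algebra) ring_enveloping_algebra: "ring (enveloping_algebra scale bracket L)"
  unfolding enveloping_algebra_def
  by (intro ideal.quotient_is_ring ring.genideal_ideal ring_free_algebra
        enveloping_relations_carrier)


section \<open>The Lie algebras \<open>L(f,g)\<close>\<close>

text \<open>The derivation \<open>p\<partial>\<close> is represented by the polynomial \<open>p\<close>, so \<open>W = Der(k[t])\<close> is carried by the
  whole type \<open>'k poly\<close>.\<close>

definition witt_bracket :: "'k::field poly \<Rightarrow> 'k poly \<Rightarrow> 'k poly" where
  "witt_bracket p q = p * pderiv q - pderiv p * q"

definition poly_subalgebra :: "'k::field poly \<Rightarrow> 'k poly set" where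
  "poly_subalgebra f = range (\<lambda>h. pcompose h f)"

definition L_alg :: "'k::field poly \<Rightarrow> 'k poly \<Rightarrow> 'k poly set" where
  "L_alg f g = module.span smult {f ^ n * g | n. True}"

lemma vector_space_poly: "vector_space (smult :: 'k::field \<Rightarrow> 'k poly \<Rightarrow> 'k poly)"
  by standard (simp_all add: smult_add_left smult_add_right)

lemma pcompose_monom: "pcompose (monom c n) f = smult c (f ^ n)" for f :: "'k::field poly"
  by (induction n) (simp_all add: monom_0 monom_Suc pcompose_pCons mult.commute)

lemma L_alg_eq: "L_alg f g = {p * g | p. p \<in> poly_subalgebra f}"
proof -
  interpret vector_space "smult :: 'a \<Rightarrow> 'a poly \<Rightarrow> 'a poly"
    by (rule vector_space_poly)
  let ?R = "{p * g | p. p \<in> poly_subalgebra f}"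
  have "subspace ?R"
  proof (rule subspaceI)
    show "0 \<in> ?R"
      unfolding poly_subalgebra_def by (auto intro!: exI[of _ 0] rev_image_eqI[of 0])
  next
    fix x y assume "x \<in> ?R" "y \<in> ?R"
    then obtain p q where "x = pcompose p f * g" "y = pcompose q f * g"
      unfolding poly_subalgebra_def by auto
    then have "x + y = pcompose (p + q) f * g"
      by (simp add: pcompose_add algebra_simps)
    then show "x + y \<in> ?R" unfolding poly_subalgebra_def by blast
  next
    fix c x assume "x \<in> ?R"
    then obtain p where "x = pcompose p f * g"
      unfolding poly_subalgebra_def by auto
    then have "smult c x = pcompose (smult c p) f * g"
      by (simp add: pcompose_smult)
    then show "smult c x \<in> ?R" unfolding poly_subalgebra_def by blast
  qed
  moreover have "{f ^ n * g | n. True} \<subseteq> ?R"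
  proof clarify
    fix n
    have "f ^ n = pcompose (monom 1 n) f"
      by (simp add: pcompose_monom)
    then show "\<exists>p. f ^ n * g = p * g \<and> p \<in> poly_subalgebra f"
      unfolding poly_subalgebra_def by auto
  qed
  ultimately have "L_alg f g \<subseteq> ?R"
    unfolding L_alg_def by (rule span_minimal[rotated])
  moreover have "?R \<subseteq> L_alg f g"
  proof clarify
    fix p assume "p \<in> poly_subalgebra f"
    then obtain h where p: "p = pcompose h f" unfolding poly_subalgebra_def by auto
    have "p * g = (\<Sum>i\<le>degree h. smult (coeff h i) (f ^ i * g))"
      unfolding p
      by (subst (1) poly_as_sum_of_monoms[symmetric])
        (simp add: pcompose_sum pcompose_monom sum_distrib_right)
    also have "\<dots> \<in> L_alg f g"
      unfolding L_alg_def by (intro span_sum span_scale span_base) blast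
    finally show "p * g \<in> L_alg f g" .
  qed
  ultimately show ?thesis by blast
qed

lemma lie_algebra_L_alg:
  assumes "pderiv f * g \<in> poly_subalgebra f"
  shows "lie_algebra smult witt_bracket (L_alg f g)"
proof -
  interpret vector_space "smult :: 'a \<Rightarrow> 'a poly \<Rightarrow> 'a poly"
    by (rule vector_space_poly)
  obtain h where h: "pderiv f * g = pcompose h f"
    using assms unfolding poly_subalgebra_def by auto
  have closed: "witt_bracket x y \<in> L_alg f g" if xy: "x \<in> L_alg f g" "y \<in> L_alg f g" for x y
  proof -
    obtain p q where p: "x = pcompose p f * g" and q: "y = pcompose q f * g"
      using xy unfolding L_alg_eq poly_subalgebra_def by auto
    have "witt_bracket x y =
        (pcompose p f * pcompose (pderiv q) f - pcompose (pderiv p) f * pcompose q f)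
          * (pderiv f * g) * g"
      unfolding witt_bracket_def p q by (simp add: pderiv_mult pderiv_pcompose algebra_simps)
    also have "\<dots> = pcompose ((p * pderiv q - pderiv p * q) * h) f * g"
      by (simp add: h pcompose_mult pcompose_diff)
    finally show ?thesis unfolding L_alg_eq poly_subalgebra_def by blast
  qed
  show ?thesis
  proof
    show "subspace (L_alg f g)" unfolding L_alg_def by (rule subspace_span)
  qed (use closed in simp, simp_all add: witt_bracket_def pderiv_mult pderiv_add pderiv_diff
      pderiv_smult smult_diff_right algebra_simps)
qed

end

theory Submission
  imports Defs "HOL-Library.Product_Plus"
begin

text \<open>
  Over the dual numbers \<open>k[\<epsilon>]\<close>, \<open>\<epsilon>\<^sup>2 = 0\<close>, the Lie algebra \<open>W = k[t]\<partial>\<close> acts from the right on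
  \<open>M = k[t] \<oplus> \<epsilon>k[t]\<close> by \<open>m \<cdot> x\<partial> = - xm' + \<epsilon>x'm\<close>, a first-order deformation of its natural action
  by the divergence cocycle \<open>x\<partial> \<mapsto> x'\<close>. Restricting to \<open>L = L(f,g)\<close> makes \<open>M\<close> a right module over
  \<open>U = U(L)\<close>. Three things about this module matter.

  First, \<open>L\<close> kills the constants modulo \<open>\<epsilon>\<close>, so \<open>1 \<cdot> b\<close> is congruent to a constant \<open>c(b)\<close> modulo
  \<open>\<epsilon>M\<close> for every \<open>b \<in> U\<close>. Secondly, let \<open>J\<close> be the set of all \<open>u \<in> U\<close> that kill
  \<open>\<epsilon>M\<close> and send \<open>1\<close> into \<open>\<epsilon>M\<close>, and write \<open>1 \<cdot> u = \<epsilon>\<theta>(u)\<close> for \<open>u \<in> J\<close>; then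
  \<open>1 \<cdot> bu = (1 \<cdot> b) \<cdot> u = c(b)\<epsilon>\<theta>(u)\<close>. Left multiplication therefore only rescales \<open>\<theta>\<close>, and the
  elements of \<open>J\<close> with \<open>deg \<theta>(u) \<le> N\<close> form a left ideal of \<open>U\<close> (\<open>left_ideal_bounded_ideal\<close>).
  Thirdly, these left ideals never stop growing with \<open>N\<close>: for \<open>q \<in> k[f]\<close> the element
  \<open>(fg\<partial>)(qg\<partial>) - (g\<partial>)(fqg\<partial>) + qf'g\<^sup>2\<partial>\<close>, whose last summand is in \<open>L\<close> because \<open>f'g \<in> k[f]\<close>, lies in
  \<open>J\<close> and has \<open>\<theta> = f'q'g\<^sup>2\<close> (\<open>eval_product_defect\<close>). In characteristic \<open>0\<close> the degree of this is
  unbounded as \<open>q\<close> runs through the powers of \<open>f\<close>. So \<open>U\<close> fails the ascending chain condition on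
  left ideals.

  All calculations are made with right modules over the free algebra on \<open>L\<close>: the relations of \<open>U\<close>
  act as zero, and chains of left ideals above them descend to the quotient
  (\<open>left_noetherian_Quot_chain_stabilises\<close>).
\<close>

section \<open>Ascending chains of left ideals\<close>

lemma additive_subgroup_UN_incseq:
  assumes "ring R" and "\<And>n. additive_subgroup (K n) R" and "incseq K"
  shows "additive_subgroup (\<Union>n. K n) R"
proof -
  interpret ring R by fact
  have sub: "subgroup (K n) (add_monoid R)" for n
    using assms(2) by (simp add: additive_subgroup_def)
  have "subgroup (\<Union>n. K n) (add_monoid R)"
  proof (rule add.subgroupI)
    show "(\<Union>n. K n) \<subseteq> carrier R"
      using additive_subgroup.a_subset[OF assms(2)] by (rule UN_least)
    show "(\<Union>n. K n) \<noteq> {}"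
      using additive_subgroup.zero_closed[OF assms(2), of undefined] by blast
    show "\<ominus>\<^bsub>R\<^esub> a \<in> (\<Union>n. K n)" if a: "a \<in> (\<Union>n. K n)" for a
    proof -
      obtain n where "a \<in> K n" using a by (rule UN_E)
      then have "\<ominus>\<^bsub>R\<^esub> a \<in> K n"
        unfolding a_inv_def by (rule subgroup.m_inv_closed[OF sub])
      then show ?thesis by blast
    qed
    show "a \<oplus>\<^bsub>R\<^esub> b \<in> (\<Union>n. K n)" if ab: "a \<in> (\<Union>n. K n)" "b \<in> (\<Union>n. K n)" for a b
    proof -
      obtain i j where "a \<in> K i" "b \<in> K j" using ab by blast
      then have "a \<in> K (max i j)" "b \<in> K (max i j)"
        by (simp_all add: subsetD[OF incseqD[OF \<open>incseq K\<close> max.cobounded1]]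
            subsetD[OF incseqD[OF \<open>incseq K\<close> max.cobounded2]])
      then have "a \<oplus>\<^bsub>R\<^esub> b \<in> K (max i j)" by (rule additive_subgroup.a_closed[OF assms(2)])
      then show ?thesis by blast
    qed
  qed
  then show ?thesis by (simp add: additive_subgroup_def)
qed

text \<open>Finitely many generators of the union of the chain already lie in one of its members.\<close>

lemma left_noetherian_chain_stabilises:
  assumes "ring R" and "left_noetherian R"
    and left: "\<And>n. left_ideal (K n) R" and "incseq K"
  shows "\<exists>N. \<forall>n. K n \<subseteq> K N"
proof -
  have "additive_subgroup (\<Union>n. K n) R"
    using additive_subgroup_UN_incseq[OF assms(1) _ assms(4)] left by (simp add: left_ideal_def)
  moreover have "r \<otimes>\<^bsub>R\<^esub> a \<in> (\<Union>n. K n)" if r: "r \<in> carrier R" and a: "a \<in> (\<Union>n. K n)" for r a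
  proof -
    obtain n where "a \<in> K n" using a by (rule UN_E)
    then have "r \<otimes>\<^bsub>R\<^esub> a \<in> K n" using left[of n] r by (simp add: left_ideal_def)
    then show ?thesis by (rule UN_I[OF UNIV_I])
  qed
  ultimately have "left_ideal (\<Union>n. K n) R"
    by (simp only: left_ideal_def) blast
  then have "\<exists>A \<subseteq> carrier R. finite A \<and> (\<Union>n. K n) = \<Inter> {J. left_ideal J R \<and> A \<subseteq> J}"
    using assms(2) by (simp only: left_noetherian_def)
  then obtain A where "finite A" and A: "(\<Union>n. K n) = \<Inter> {J. left_ideal J R \<and> A \<subseteq> J}"
    by (elim exE conjE)
  have "A \<subseteq> (\<Union>n. K n)" unfolding A by (rule Inter_greatest) simp
  with \<open>finite A\<close> have "\<exists>N. A \<subseteq> K N"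
  proof (induction A rule: finite_induct)
    case (insert x A)
    then obtain i j where ij: "x \<in> K i" "A \<subseteq> K j" by auto
    have "K i \<subseteq> K (max i j)" "K j \<subseteq> K (max i j)"
      by (simp_all add: incseqD[OF \<open>incseq K\<close>])
    with ij have "insert x A \<subseteq> K (max i j)" by (meson insert_subset order_trans subsetD)
    then show ?case ..
  qed simp
  then obtain N where "A \<subseteq> K N" ..
  then have "(\<Union>n. K n) \<subseteq> K N"
    unfolding A using left by (intro Inter_lower) simp
  then show ?thesis by (auto simp: UN_subset_iff)
qed

lemma left_ideal_surj_image:
  assumes "ring_hom_ring R S h" and surj: "h ` carrier R = carrier S"
    and "left_ideal K R"
  shows "left_ideal (h ` K) S"
proof -
  interpret ring_hom_ring R S h by fact
  have K: "additive_subgroup K R" "\<And>r a. r \<in> carrier R \<Longrightarrow> a \<in> K \<Longrightarrow> r \<otimes>\<^bsub>R\<^esub> a \<in> K"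
    using assms(3) by (auto simp: left_ideal_def)
  have "subgroup (h ` K) (add_monoid S)"
    using group_hom.subgroup_img_is_subgroup[OF a_group_hom] K(1)
    by (simp add: additive_subgroup_def)
  moreover have "r \<otimes>\<^bsub>S\<^esub> a \<in> h ` K" if r: "r \<in> carrier S" and a: "a \<in> h ` K" for r a
  proof -
    obtain s b where s: "s \<in> carrier R" "r = h s" and b: "b \<in> K" "a = h b"
      using r a surj by blast
    moreover have "b \<in> carrier R" using additive_subgroup.a_subset[OF K(1)] b by blast
    ultimately have "r \<otimes>\<^bsub>S\<^esub> a = h (s \<otimes>\<^bsub>R\<^esub> b)" by simp
    then show ?thesis using K(2)[OF s(1) b(1)] by simp
  qed
  ultimately show ?thesis by (simp add: left_ideal_def additive_subgroup_def)
qed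

text \<open>Left ideals of a quotient correspond to the left ideals above the kernel, so chains of
  the latter can be studied without ever calculating with cosets.\<close>

lemma left_noetherian_Quot_chain_stabilises:
  assumes "ring R" and "ideal I R" and "left_noetherian (R Quot I)"
    and left: "\<And>n. left_ideal (K n) R" and "incseq K" and above: "\<And>n. I \<subseteq> K n"
  shows "\<exists>N. \<forall>n. K n \<subseteq> K N"
proof -
  interpret R: ring R by fact
  interpret I: ideal I R by fact
  let ?h = "(+>\<^bsub>R\<^esub>) I"
  have hom: "ring_hom_ring R (R Quot I) ?h" by (rule I.rcos_ring_hom_ring)
  have surj: "?h ` carrier R = carrier (R Quot I)"
    by (auto simp: FactRing_def A_RCOSETS_def')
  have "incseq (\<lambda>n. ?h ` K n)"
    by (intro incseq_SucI image_mono incseq_SucD[OF \<open>incseq K\<close>])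
  then have "\<exists>N. \<forall>n. ?h ` K n \<subseteq> ?h ` K N"
    by (intro left_noetherian_chain_stabilises[OF I.quotient_is_ring assms(3)]
        left_ideal_surj_image[OF hom surj left])
  then obtain N where N: "\<And>n. ?h ` K n \<subseteq> ?h ` K N" by blast
  have "K n \<subseteq> K N" for n
  proof
    fix a assume a: "a \<in> K n"
    then obtain b where b: "b \<in> K N" "I +>\<^bsub>R\<^esub> a = I +>\<^bsub>R\<^esub> b" using N by blast
    have sub: "additive_subgroup (K m) R" for m using left by (simp add: left_ideal_def)
    have car: "a \<in> carrier R" "b \<in> carrier R"
      using a b additive_subgroup.a_subset[OF sub] by blast+
    have "a \<ominus>\<^bsub>R\<^esub> b \<in> K N"
      using R.quotient_eq_iff_same_a_r_cos[OF assms(2) car] b above by blast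
    then have "(a \<ominus>\<^bsub>R\<^esub> b) \<oplus>\<^bsub>R\<^esub> b \<in> K N"
      using b(1) by (rule additive_subgroup.a_closed[OF sub])
    moreover have "(a \<ominus>\<^bsub>R\<^esub> b) \<oplus>\<^bsub>R\<^esub> b = a" using car by algebra
    ultimately show "a \<in> K N" by simp
  qed
  then show ?thesis by blast
qed


section \<open>Right modules over the free algebra\<close>

lemma free_algebra_simps [simp]:
  "x \<oplus>\<^bsub>free_algebra X\<^esub> y = x + y" "x \<otimes>\<^bsub>free_algebra X\<^esub> y = x * y" "\<zero>\<^bsub>free_algebra X\<^esub> = 0"
  by (simp_all add: free_algebra_def)

lemma a_inv_free_algebra:
  assumes "p \<in> carrier (free_algebra X)"
  shows "\<ominus>\<^bsub>free_algebra X\<^esub> p = - p"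
  using abelian_group.l_neg[OF ring.is_abelian_group[OF ring_free_algebra] assms]
  by (simp add: eq_neg_iff_add_eq_0)

lemma a_minus_free_algebra:
  assumes "q \<in> carrier (free_algebra X)"
  shows "p \<ominus>\<^bsub>free_algebra X\<^esub> q = p - q"
  using assms by (simp add: a_minus_def a_inv_free_algebra)

locale word_action = vector_space scale
  for scale :: "'k::field \<Rightarrow> 'm::ab_group_add \<Rightarrow> 'm" +
  fixes act :: "'v \<Rightarrow> 'm \<Rightarrow> 'm"
  assumes act_add: "act x (m + n) = act x m + act x n"
    and act_scale: "act x (scale c m) = scale c (act x m)"
begin

definition word_act :: "'v fword \<Rightarrow> 'm \<Rightarrow> 'm" where
  "word_act w = fold act (letters w)"

definition eval :: "('v fword \<Rightarrow>\<^sub>0 'k) \<Rightarrow> 'm \<Rightarrow> 'm" where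
  "eval p m = (\<Sum>w \<in> Poly_Mapping.keys p. scale (Poly_Mapping.lookup p w) (word_act w m))"

lemma fold_act_linear:
  "fold act xs (m + n) = fold act xs m + fold act xs n"
  "fold act xs (scale c m) = scale c (fold act xs m)"
  by (induction xs arbitrary: m n) (simp_all add: act_add act_scale)

lemma eval_superset:
  assumes "finite S" and "Poly_Mapping.keys p \<subseteq> S"
  shows "eval p m = (\<Sum>w \<in> S. scale (Poly_Mapping.lookup p w) (word_act w m))"
  unfolding eval_def
  by (rule sum.mono_neutral_left) (use assms in \<open>auto simp: in_keys_iff\<close>)

lemma eval_zero [simp]: "eval 0 m = 0"
  by (simp add: eval_def)

lemma eval_add: "eval (p + q) m = eval p m + eval q m"
proof -
  let ?S = "Poly_Mapping.keys p \<union> Poly_Mapping.keys q"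
  show ?thesis
    using Poly_Mapping.keys_add[of p q]
    by (simp add: eval_superset[of ?S] lookup_add scale_left_distrib sum.distrib)
qed

lemma eval_uminus: "eval (- p) m = - eval p m"
  using eval_add[of p "- p" m] by (simp add: eq_neg_iff_add_eq_0 add.commute)

lemma eval_diff: "eval (p - q) m = eval p m - eval q m"
  using eval_add[of p "- q" m] by (simp add: eval_uminus)

lemma eval_sum: "eval (\<Sum>i \<in> A. p i) m = (\<Sum>i \<in> A. eval (p i) m)"
  by (induction A rule: infinite_finite_induct) (simp_all add: eval_add)

lemma eval_single [simp]: "eval (Poly_Mapping.single w c) m = scale c (word_act w m)"
  by (subst eval_superset[of "{w}"]) simp_all

lemma eval_free_gen [simp]: "eval (free_gen x) m = act x m"
  by (simp add: free_gen_def word_act_def)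

lemma eval_add_right: "eval p (m + n) = eval p m + eval p n"
  by (simp add: eval_def word_act_def fold_act_linear scale_right_distrib sum.distrib)

lemma eval_scale: "eval p (scale c m) = scale c (eval p m)"
  by (simp add: eval_def word_act_def fold_act_linear scale_sum_right mult.commute)

lemma eval_zero_right: "eval p 0 = 0"
  using eval_scale[of p 0 0] by simp

lemma eval_sum_right: "eval p (\<Sum>i \<in> A. m i) = (\<Sum>i \<in> A. eval p (m i))"
  by (induction A rule: infinite_finite_induct) (simp_all add: eval_add_right eval_zero_right)

text \<open>Words act letter by letter from left to right, so the order of a product is reversed when
  it is read as a composition of maps: this is a right action.\<close>

lemma eval_mult: "eval (p * q) m = eval q (eval p m)"
proof -
  have expand: "r = (\<Sum>w \<in> Poly_Mapping.keys r. Poly_Mapping.single w (Poly_Mapping.lookup r w))"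
    for r :: "'v fword \<Rightarrow>\<^sub>0 'k"
    by (rule poly_mapping_eqI) (simp add: lookup_sum lookup_single when_def in_keys_iff)
  have comp: "word_act (u + w) m = word_act w (word_act u m)" for u w
    by (simp add: word_act_def plus_fword_def)
  have lin: "word_act w (scale c m) = scale c (word_act w m)" for w c m
    by (simp add: word_act_def fold_act_linear)
  have single: "eval (Poly_Mapping.single u a * q) m = eval q (scale a (word_act u m))" for u a
    by (subst (1 2) expand[of q])
      (simp add: sum_distrib_left mult_single eval_sum comp lin mult.commute)
  show ?thesis
    by (subst (1 2) expand[of p])
      (simp add: sum_distrib_right eval_sum eval_sum_right single)
qed

lemma eval_mem_subspace:
  assumes S: "subspace S" and act: "\<And>x m. m \<in> S \<Longrightarrow> act x m \<in> S" and "m \<in> S"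
  shows "eval p m \<in> S"
proof -
  have "fold act xs m \<in> S" for xs
    using \<open>m \<in> S\<close> by (induction xs arbitrary: m) (simp_all add: act)
  then show ?thesis
    unfolding eval_def word_act_def by (intro subspace_sum[OF S] subspace_scale[OF S])
qed

lemma ideal_annihilator:
  "ideal {p \<in> carrier (free_algebra X). \<forall>m. eval p m = 0} (free_algebra X)" (is "ideal ?I ?F")
proof -
  interpret F: ring ?F by (rule ring_free_algebra)
  show ?thesis
  proof (rule idealI[OF ring_free_algebra])
    show "subgroup ?I (add_monoid ?F)"
    proof (rule F.add.subgroupI)
      show "?I \<noteq> {}" using F.zero_closed by (auto intro!: exI[of _ 0])
      fix p assume p: "p \<in> ?I"
      then show "\<ominus>\<^bsub>?F\<^esub> p \<in> ?I"
        using F.a_inv_closed[of p] by (simp add: a_inv_free_algebra eval_uminus)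
    next
      fix p q assume "p \<in> ?I" "q \<in> ?I"
      then show "p \<oplus>\<^bsub>?F\<^esub> q \<in> ?I"
        using F.add.m_closed[of p q] by (simp add: eval_add)
    qed auto
  next
    fix a x assume "a \<in> ?I" "x \<in> carrier ?F"
    then show "x \<otimes>\<^bsub>?F\<^esub> a \<in> ?I" and "a \<otimes>\<^bsub>?F\<^esub> x \<in> ?I"
      using F.m_closed[of x a] F.m_closed[of a x]
      by (simp_all add: eval_mult eval_zero_right)
  qed
qed

end


section \<open>A module over the dual numbers\<close>

definition pair_scale :: "'k::field \<Rightarrow> 'k poly \<times> 'k poly \<Rightarrow> 'k poly \<times> 'k poly" where
  "pair_scale c m = (smult c (fst m), smult c (snd m))"

text \<open>A pair \<open>(u, v)\<close> stands for \<open>u + \<epsilon>v\<close> with \<open>\<epsilon>\<^sup>2 = 0\<close>. In these terms \<open>x\<partial>\<close> sends \<open>m\<close> to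
  \<open>- xm' + \<epsilon>x'm\<close>; the sign of the first term makes the action a right action.\<close>

definition dual_act :: "'k::field poly \<Rightarrow> 'k poly \<times> 'k poly \<Rightarrow> 'k poly \<times> 'k poly" where
  "dual_act x m = (- x * pderiv (fst m), pderiv x * fst m - x * pderiv (snd m))"

interpretation dual: word_action "pair_scale :: 'k::field \<Rightarrow> _" dual_act
  by standard
    (auto simp: pair_scale_def dual_act_def pderiv_add pderiv_smult algebra_simps smult_add_right
      smult_add_left smult_diff_right)

text \<open>For the bracket relation this says that \<open>x \<mapsto> x'\<close> is a 1-cocycle of the Lie algebra of vector
  fields with values in functions: \<open>[x,y]' = xy'' - x''y\<close>.\<close>

lemma witt_relations_annihilate:
  assumes "p \<in> enveloping_relations smult witt_bracket L"
  shows "dual.eval p m = 0"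
proof -
  have "dual_act (x + y) m = dual_act x m + dual_act y m" for x y
    by (simp add: dual_act_def pderiv_add algebra_simps)
  moreover have "dual_act (smult c x) m = pair_scale c (dual_act x m)" for c x
    by (simp add: dual_act_def pair_scale_def pderiv_smult smult_diff_right)
  moreover have "dual_act y (dual_act x m) - dual_act x (dual_act y m) = dual_act (witt_bracket x y) m"
    for x y
    by (simp add: dual_act_def witt_bracket_def pderiv_mult pderiv_diff pderiv_minus algebra_simps)
  ultimately show ?thesis
    using assms unfolding enveloping_relations_def
    by (auto simp: dual.eval_diff dual.eval_mult dual.word_act_def)
qed

text \<open>Killing \<open>\<epsilon>k[t]\<close> is what makes the degree bound stable under left multiplication by \<open>b\<close>: only
  the class of \<open>1 \<cdot> b\<close> modulo \<open>\<epsilon>\<close> then matters.\<close>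

definition bounded_ideal :: "'k::field poly set \<Rightarrow> nat \<Rightarrow> ('k poly fword \<Rightarrow>\<^sub>0 'k) set" where
  "bounded_ideal L N = {p \<in> carrier (free_algebra L). (\<forall>v. dual.eval p (0, v) = 0) \<and>
     fst (dual.eval p (1, 0)) = 0 \<and> degree (snd (dual.eval p (1, 0))) \<le> N}"

text \<open>Since constants have derivative \<open>0\<close>, the product \<open>1 \<cdot> b\<close> is a constant \<open>c\<close> modulo \<open>\<epsilon>k[t]\<close>, and
  \<open>\<epsilon>k[t]\<close> is killed by \<open>p\<close>. Hence \<open>1 \<cdot> bp = c(1 \<cdot> p)\<close>, and left multiplication cannot raise the degree.\<close>

lemma left_ideal_bounded_ideal: "left_ideal (bounded_ideal L N) (free_algebra L)"
proof -
  let ?F = "free_algebra L :: ('a poly fword \<Rightarrow>\<^sub>0 'a) ring"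
  let ?K = "bounded_ideal L N"
  interpret F: ring ?F by (rule ring_free_algebra)
  have "subgroup ?K (add_monoid ?F)"
  proof (rule F.add.subgroupI)
    show "?K \<subseteq> carrier ?F" by (auto simp: bounded_ideal_def)
    have "0 \<in> ?K" using F.zero_closed by (simp add: bounded_ideal_def)
    then show "?K \<noteq> {}" by blast
    fix p assume p: "p \<in> ?K"
    then have pc: "p \<in> carrier ?F" by (simp add: bounded_ideal_def)
    show "\<ominus>\<^bsub>?F\<^esub> p \<in> ?K"
      using p F.a_inv_closed[OF pc] by (simp add: a_inv_free_algebra[OF pc] bounded_ideal_def dual.eval_uminus)
  next
    fix p q assume "p \<in> ?K" "q \<in> ?K"
    then show "p \<oplus>\<^bsub>?F\<^esub> q \<in> ?K"
      using F.add.m_closed[of p q]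
      by (auto simp: bounded_ideal_def dual.eval_add intro: degree_add_le)
  qed
  moreover have "b \<otimes>\<^bsub>?F\<^esub> p \<in> ?K" if b: "b \<in> carrier ?F" and p: "p \<in> ?K" for b p
  proof -
    have "dual.eval b (0, v) \<in> {m. fst m = 0}" for v
      by (rule dual.eval_mem_subspace)
        (auto simp: dual.subspace_def pair_scale_def dual_act_def)
    then have low: "dual.eval b (0, v) = (0, snd (dual.eval b (0, v)))" for v
      by (simp add: prod_eq_iff)
    let ?C = "{m :: 'a poly \<times> 'a poly. \<exists>c. fst m = [:c:]}"
    have "dual.subspace ?C"
    proof (rule dual.subspaceI)
      show "0 \<in> ?C" by (auto intro: exI[of _ 0])
    qed (auto simp: pair_scale_def)
    moreover have "dual_act x m \<in> ?C" if m: "m \<in> ?C" for x m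
    proof -
      have "pderiv (fst m) = 0" using m by (auto simp: pderiv_pCons)
      then show ?thesis by (auto simp: dual_act_def intro: exI[of _ 0])
    qed
    moreover have "(1, 0) \<in> ?C" by (simp add: one_pCons)
    ultimately have "dual.eval b (1, 0) \<in> ?C" by (rule dual.eval_mem_subspace)
    then obtain c where c: "fst (dual.eval b (1, 0)) = [:c:]" by blast
    have "dual.eval b (1, 0) = pair_scale c (1, 0) + (0, snd (dual.eval b (1, 0)))"
      by (simp add: prod_eq_iff pair_scale_def c)
    have pv: "dual.eval p (0, v) = 0" for v using p by (simp add: bounded_ideal_def)
    have split: "dual.eval b (1, 0) = pair_scale c (1, 0) + (0, snd (dual.eval b (1, 0)))"
      by (simp add: prod_eq_iff pair_scale_def c)
    have "dual.eval p (dual.eval b (1, 0)) = pair_scale c (dual.eval p (1, 0))"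
      by (subst split) (simp only: dual.eval_add_right dual.eval_scale pv add_0_right)
    moreover have "dual.eval p (dual.eval b (0, v)) = 0" for v
      by (subst low) (rule pv)
    ultimately show ?thesis
      using p F.m_closed[OF b, of p]
      by (auto simp: bounded_ideal_def dual.eval_mult pair_scale_def
          intro: order.trans[OF degree_smult_le])
  qed
  ultimately show ?thesis by (simp add: left_ideal_def additive_subgroup_def)
qed

section \<open>Failure of the ascending chain condition\<close>

text \<open>Modulo \<open>\<epsilon>\<close>, where \<open>x\<partial>\<close> acts as a first-order differential operator, the product of
  \<open>ag\<partial>\<close> and \<open>bg\<partial>\<close> and that of \<open>g\<partial>\<close> and \<open>abg\<partial>\<close> have the same second-order part, and their
  first-order parts cancel once \<open>ba'g\<^sup>2\<partial>\<close> is added to the difference. Over the dual numbers the same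
  combination leaves multiplication by \<open>\<epsilon>a'b'g\<^sup>2\<close>, because the divergences contribute a term that
  is not determined by the product \<open>ab\<close>.\<close>

lemma eval_product_defect:
  fixes a b g :: "'k::field poly"
  defines "r \<equiv> free_gen (a * g) * free_gen (b * g) - free_gen g * free_gen (a * b * g)
    + free_gen (b * (pderiv a * g) * g)"
  shows "dual.eval r (u, v) = (0, pderiv a * pderiv b * g ^ 2 * u)"
  by (simp_all add: r_def dual.eval_add dual.eval_diff dual.eval_mult dual_act_def pderiv_mult
      pderiv_add pderiv_diff pderiv_minus algebra_simps power2_eq_square)

theorem proposition3p15:
  fixes f g :: "'k::field_char_0 poly"
  assumes "f \<noteq> 0" and "g \<noteq> 0"
    and "pderiv f * g \<in> poly_subalgebra f"
    and "degree f \<ge> 1"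
  shows "\<not> noetherian (enveloping_algebra smult witt_bracket (L_alg f g))"
proof
  let ?L = "L_alg f g"
  let ?F = "free_algebra ?L :: ('k poly fword \<Rightarrow>\<^sub>0 'k) ring"
  let ?I = "genideal ?F (enveloping_relations smult witt_bracket ?L)"
  interpret L: lie_algebra smult witt_bracket ?L
    by (rule lie_algebra_L_alg) fact
  interpret F: ring ?F by (rule ring_free_algebra)
  assume "noetherian (enveloping_algebra smult witt_bracket ?L)"
  then have noeth: "left_noetherian (?F Quot ?I)"
    by (simp add: noetherian_def enveloping_algebra_def)
  have I: "ideal ?I ?F" by (intro F.genideal_ideal L.enveloping_relations_carrier)
  have "?I \<subseteq> {p \<in> carrier ?F. \<forall>m. dual.eval p m = 0}"
    using L.enveloping_relations_carrier witt_relations_annihilate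
    by (intro F.genideal_minimal dual.ideal_annihilator) blast
  then have "?I \<subseteq> bounded_ideal ?L n" for n
    by (auto simp: bounded_ideal_def)
  moreover have "incseq (bounded_ideal ?L)"
    by (auto simp: incseq_def bounded_ideal_def)
  ultimately have "\<exists>N. \<forall>n. bounded_ideal ?L n \<subseteq> bounded_ideal ?L N"
    by (intro left_noetherian_Quot_chain_stabilises[OF F.ring_axioms I noeth]
        left_ideal_bounded_ideal)
  then obtain N where N: "\<And>n. bounded_ideal ?L n \<subseteq> bounded_ideal ?L N" by blast
  \<comment> \<open>The exponent leaves room for the loss of one degree in \<open>q'\<close> when \<open>f\<close> is linear.\<close>
  define q where "q = f ^ (N + 2)"
  define r :: "'k poly fword \<Rightarrow>\<^sub>0 'k" where
    "r = free_gen (f * g) * free_gen (q * g) - free_gen g * free_gen (f * q * g)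
      + free_gen (q * (pderiv f * g) * g)"
  have pow: "f ^ n \<in> poly_subalgebra f" for n
    unfolding poly_subalgebra_def by (rule range_eqI[of _ _ "monom 1 n"]) (simp add: pcompose_monom)
  have prod: "a * b \<in> poly_subalgebra f" if "a \<in> poly_subalgebra f" "b \<in> poly_subalgebra f" for a b
    using that unfolding poly_subalgebra_def by (auto simp: pcompose_mult[symmetric])
  have mem: "a * g \<in> ?L" if "a \<in> poly_subalgebra f" for a
    using that unfolding L_alg_eq by blast
  have gen: "free_gen x \<in> carrier ?F" if "x \<in> ?L" for x
    using that by (simp add: free_algebra_def free_gen_def)
  have mems: "f * g \<in> ?L" "q * g \<in> ?L" "g \<in> ?L" "f * q * g \<in> ?L" "q * (pderiv f * g) * g \<in> ?L"
    using mem[of f] mem[of q] mem[of 1] mem[of "f * q"] mem[of "q * (pderiv f * g)"]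
      pow[of 0] pow[of 1] pow[of "N + 2"] prod assms(3) by (auto simp: q_def)
  then have "free_gen (f * g) \<otimes>\<^bsub>?F\<^esub> free_gen (q * g)
      \<ominus>\<^bsub>?F\<^esub> free_gen g \<otimes>\<^bsub>?F\<^esub> free_gen (f * q * g) \<oplus>\<^bsub>?F\<^esub> free_gen (q * (pderiv f * g) * g) \<in> carrier ?F"
    by (intro F.a_closed F.minus_closed F.m_closed gen)
  moreover have "free_gen g \<otimes>\<^bsub>?F\<^esub> free_gen (f * q * g) \<in> carrier ?F"
    using mems by (intro F.m_closed gen)
  ultimately have r_carrier: "r \<in> carrier ?F"
    by (simp add: r_def a_minus_free_algebra)
  let ?w = "pderiv f * pderiv q * g ^ 2"
  have r_eval: "dual.eval r (u, v) = (0, ?w * u)" for u v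
    unfolding r_def by (rule eval_product_defect)
  have "r \<in> bounded_ideal ?L (degree ?w)"
    using r_carrier by (simp add: bounded_ideal_def r_eval zero_prod_def)
  then have "degree ?w \<le> N"
    using N[of "degree ?w"] by (auto simp: bounded_ideal_def r_eval)
  moreover have "N < degree ?w"
  proof -
    have deg_q: "degree q = (N + 2) * degree f"
      unfolding q_def by (rule degree_power_eq) (rule assms(1))
    moreover have "N + 2 \<le> (N + 2) * degree f"
      using mult_le_mono2[OF assms(4), of "N + 2"] by (simp only: mult_1_right)
    ultimately have "N < degree (pderiv q)"
      unfolding degree_pderiv by linarith
    moreover from this have "pderiv q \<noteq> 0" by auto
    moreover have "pderiv f \<noteq> 0" using assms(4) by (auto simp: pderiv_eq_0_iff)
    ultimately show ?thesis
      using assms(2) by (simp add: degree_mult_eq)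
  qed
  ultimately show False by simp
qed

end
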